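(* Let $\mathbf{X}=(\mathbf{X}_1^\top,\mathbf{X}_2^\top)^\top\sim EC_{q+p}(\boldsymbol{\xi},\boldsymbol{\Omega},h^{(q+p)})$ with $\mathbf{X}_1\in\mathbb{R}^q$, $\mathbf{X}_2\in\mathbb{R}^p$, and let $\mathbf{Y}\sim TSLCT\text{-}EC_{p,q}(\boldsymbol{\xi},\boldsymbol{\Omega},h^{(q+p)},C(\mathbf{0});(\mathbf{a},\mathbf{b}))$ with $C(\mathbf{0})=\{\mathbf{x}_1\in\mathbb{R}^q:\mathbf{x}_1>\mathbf{0}\}$. Partition $\mathbf{Y}=(\mathbf{Y}_1^\top,\mathbf{Y}_2^\top)^\top$ with dimensions $p_1$ and $p_2$ ($p_1+p_2=p$), and partition $\mathbf{X}_2=(\mathbf{X}_{21}^\top,\mathbf{X}_{22}^\top)^\top$, $\mathbf{a}=(\mathbf{a}_1^\top,\mathbf{a}_2^\top)^\top$, $\mathbf{b}=(\mathbf{b}_1^\top,\mathbf{b}_2^\top)^\top$ accordingly. Let $\mathbf{Y}_0=(\mathbf{Y}_{01}^\top,\mathbf{Y}_{02}^\top)^\top\sim SLCT\text{-}EC_{p,q}(\boldsymbol{\xi},\boldsymbol{\Omega},h^{(q+p)},C(\mathbf{0}))$. For a value $\mathbf{y}_1$ of $\mathbf{Y}_1$ put $$\mathbf{X}_1^*\overset{d}{=}\mathbf{X}_1\mid(\mathbf{X}_{21}=\mathbf{y}_1),\quad \mathbf{Y}_0^*\overset{d}{=}\mathbf{Y}_{02}\mid(\mathbf{Y}_{01}=\mathbf{y}_1),\quad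 \mathbf{W}_0^*\overset{d}{=}\mathbf{X}_{22}\mid(\mathbf{X}_{21}=\mathbf{y}_1,\mathbf{X}_1=\mathbf{0}),\quad \mathbf{W}_2\overset{d}{=}\mathbf{W}_0^*\mid(\mathbf{a}_2\le\mathbf{W}_0^*\le\mathbf{b}_2).$$ Then, for any measurable $g:\mathbb{R}^{p_2}\to\mathbb{R}$ and (almost every) value $\mathbf{y}_1$ of $\mathbf{Y}_1$, $$\mathbb{E}\left[g(\mathbf{Y}_2)\,\frac{f_{\mathbf{X}_1}(\mathbf{0}\mid\mathbf{X}_2=\mathbf{Y})}{\mathbb{P}(\mathbf{X}_1>\mathbf{0}\mid\mathbf{X}_2=\mathbf{Y})}\;\middle|\;\mathbf{Y}_1=\mathbf{y}_1\right]=\frac{\mathbb{P}(\mathbf{a}_2\le\mathbf{W}_0^*\le\mathbf{b}_2)}{\mathbb{P}(\mathbf{a}_2\le\mathbf{Y}_0^*\le\mathbf{b}_2)}\,\frac{\mathbb{E}[g(\mathbf{W}_2)]}{\mathbb{P}(\mathbf{X}_1^*>\mathbf{0})}\,f_{\mathbf{X}_1^*}(\mathbf{0}).$$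
   Context: Elliptical distribution: $\mathbf{X}\sim EC_{r}(\boldsymbol{\xi},\boldsymbol{\Omega},h^{(r)})$ means that $\mathbf{X}$ has density $|\boldsymbol{\Omega}|^{-1/2}h^{(r)}\big((\mathbf{x}-\boldsymbol{\xi})^\top\boldsymbol{\Omega}^{-1}(\mathbf{x}-\boldsymbol{\xi})\big)$ on $\mathbb{R}^r$, with $\boldsymbol{\Omega}$ positive definite. $f_{\mathbf{U}}$ denotes the density of a random vector $\mathbf{U}$, and conditional densities such as $f_{\mathbf{X}_1}(\cdot\mid\mathbf{X}_2=\mathbf{y})$ are ratios of joint to marginal densities. $SLCT\text{-}EC_{p,q}(\boldsymbol{\xi},\boldsymbol{\Omega},h^{(q+p)},C)$ is the conditional law of $\mathbf{X}_2$ given $\mathbf{X}_1\in C$; $TSLCT\text{-}EC_{p,q}(\boldsymbol{\xi},\boldsymbol{\Omega},h^{(q+p)},C;(\mathbf{a},\mathbf{b}))$ is the law of $\mathbf{Y}_0\mid(\mathbf{a}\le\mathbf{Y}_0\le\mathbf{b})$ with $\mathbf{Y}_0\sim SLCT\text{-}EC_{p,q}(\boldsymbol{\xi},\boldsymbol{\Omega},h^{(q+p)},C)$, where $\mathbf{a},\mathbf{b}$ may have infinite entries. Vector inequalities are componentwise. It is understood that conditioning events have positive probability, that $f_{\mathbf{X}_1^*}(\mathbf{0})>0$ (so that $\mathbf{W}_0^*$ is defined), and that $g$ is such that the expectations are defined. *)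

theory Defs
  imports "HOL-Probability.Probability"
begin

text \<open>A vector of dimension \<open>m + n\<close> is indexed by the sum type; its blocks are the \<open>Inl\<close>- and
  the \<open>Inr\<close>-coordinates.\<close>

definition blk_fst :: "'a ^ ('m::finite + 'n::finite) \<Rightarrow> 'a ^ 'm" where
  "blk_fst x = (\<chi> i. x $ Inl i)"

definition blk_snd :: "'a ^ ('m::finite + 'n::finite) \<Rightarrow> 'a ^ 'n" where
  "blk_snd x = (\<chi> j. x $ Inr j)"

definition blk_join :: "'a ^ 'm::finite \<Rightarrow> 'a ^ 'n::finite \<Rightarrow> 'a ^ ('m + 'n)" where
  "blk_join u v = (\<chi> k. case k of Inl i \<Rightarrow> u $ i | Inr j \<Rightarrow> v $ j)"

definition pos_orthant :: "(real ^ 'n::finite) set" where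
  "pos_orthant = {x. \<forall>i. 0 < x $ i}"

text \<open>The bounds are extended reals, so that one-sided and absent truncation are included.\<close>

definition trunc_box :: "ereal ^ 'n::finite \<Rightarrow> ereal ^ 'n \<Rightarrow> (real ^ 'n) set" where
  "trunc_box a b = {y. \<forall>i. a $ i \<le> ereal (y $ i) \<and> ereal (y $ i) \<le> b $ i}"

definition pos_definite :: "real ^ 'n ^ 'n::finite \<Rightarrow> bool" where
  "pos_definite A \<longleftrightarrow> transpose A = A \<and> (\<forall>x. x \<noteq> 0 \<longrightarrow> 0 < x \<bullet> (A *v x))"

definition ec_density ::
    "real ^ 'n \<Rightarrow> real ^ 'n ^ 'n \<Rightarrow> (real \<Rightarrow> real) \<Rightarrow> real ^ 'n::finite \<Rightarrow> real" where
  "ec_density \<xi> \<Omega> h x = det \<Omega> powr (- 1 / 2) * h ((x - \<xi>) \<bullet> (matrix_inv \<Omega> *v (x - \<xi>)))"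

text \<open>The quadratic form only takes values in \<open>[0, \<infinity>)\<close>, so the values of \<open>h\<close> at negative
  arguments are irrelevant. Non-negativity of \<open>h\<close> has to be required separately, since \<open>ennreal\<close>
  would truncate negative values of the density.\<close>

definition elliptical ::
    "'s measure \<Rightarrow> ('s \<Rightarrow> real ^ 'n::finite) \<Rightarrow> real ^ 'n \<Rightarrow> real ^ 'n ^ 'n \<Rightarrow> (real \<Rightarrow> real) \<Rightarrow> bool" where
  "elliptical M X \<xi> \<Omega> h \<longleftrightarrow>
     prob_space M \<and> pos_definite \<Omega> \<and> (\<forall>u\<ge>0. 0 \<le> h u) \<and>
     distributed M lborel X (\<lambda>x. ennreal (ec_density \<xi> \<Omega> h x))"

definition ec_law :: "real ^ 'n \<Rightarrow> real ^ 'n ^ 'n \<Rightarrow> (real \<Rightarrow> real) \<Rightarrow> (real ^ 'n::finite) measure" where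
  "ec_law \<xi> \<Omega> h = density lborel (\<lambda>x. ennreal (ec_density \<xi> \<Omega> h x))"

text \<open>\<open>uniform_measure P A\<close> is the conditional probability measure of \<open>P\<close> given the event \<open>A\<close>,
  that is \<open>B \<mapsto> P (A \<inter> B) / P A\<close>.\<close>

definition slct_ec ::
    "real ^ ('q + 'p) \<Rightarrow> real ^ ('q + 'p) ^ ('q + 'p) \<Rightarrow> (real \<Rightarrow> real) \<Rightarrow> (real ^ 'q::finite) set
      \<Rightarrow> (real ^ 'p::finite) measure" where
  "slct_ec \<xi> \<Omega> h C = distr (uniform_measure (ec_law \<xi> \<Omega> h) {x. blk_fst x \<in> C}) borel blk_snd"

definition tslct_ec ::
    "real ^ ('q + 'p) \<Rightarrow> real ^ ('q + 'p) ^ ('q + 'p) \<Rightarrow> (real \<Rightarrow> real) \<Rightarrow> (real ^ 'q::finite) set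
      \<Rightarrow> ereal ^ 'p \<Rightarrow> ereal ^ 'p \<Rightarrow> (real ^ 'p::finite) measure" where
  "tslct_ec \<xi> \<Omega> h C a b = uniform_measure (slct_ec \<xi> \<Omega> h C) (trunc_box a b)"

text \<open>For a joint density \<open>f u v\<close> of \<open>(U, V)\<close>: the density and the law of \<open>U\<close> given \<open>V = v\<close>.
  The conditioning value is the first argument after \<open>f\<close>.\<close>

definition cond_density :: "('u::euclidean_space \<Rightarrow> 'v \<Rightarrow> real) \<Rightarrow> 'v \<Rightarrow> 'u \<Rightarrow> real" where
  "cond_density f v u = f u v / (\<integral>u'. f u' v \<partial>lborel)"

definition cond_law :: "('u::euclidean_space \<Rightarrow> 'v \<Rightarrow> real) \<Rightarrow> 'v \<Rightarrow> 'u measure" where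
  "cond_law f v = density lborel (\<lambda>u. ennreal (cond_density f v u))"

end

(* Write F u w for the joint density at x1 = u, x2 = (y1, w). Bayes' rule gives fY0 (y1, w) =
   (integral of F u w over u > 0) / P, and truncation restricts this to the box. The orthant integral
   cancels against P(X1 > 0 | X2 = (y1, w)), so both sides equal the integral of g w * F 0 w over the
   box, divided by the integral of F over the orthant times the box.

   The cancellation needs that F 0 w > 0 forces the orthant integral to be positive, for almost every w:
   otherwise the quotient is 0 / 0 = 0 on the left, while W0* still charges w. This uses the elliptical
   form of F, a positive definite quadratic polynomial q composed with h: for almost every w with
   h (q 0 w) > 0, the set {h > 0} has positive measure to the right of q 0 w, and q attains all
   sufficiently large values on rays in the orthant. *)

theory Submission
  imports Defs
begin

section \<open>Block vectors: coordinates, measurability and Lebesgue measure\<close>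

lemma blk_fst_join [simp]: "blk_fst (blk_join u v) = u"
  and blk_snd_join [simp]: "blk_snd (blk_join u v) = v"
  by (simp_all add: blk_fst_def blk_snd_def blk_join_def vec_eq_iff)

lemma blk_join_fst_snd [simp]: "blk_join (blk_fst x) (blk_snd x) = x"
  by (simp add: blk_fst_def blk_snd_def blk_join_def vec_eq_iff split: sum.split)

lemma blk_join_nth [simp]: "blk_join u v $ Inl i = u $ i" "blk_join u v $ Inr j = v $ j"
  by (simp_all add: blk_join_def)

lemma continuous_on_blk_join [continuous_intros]:
  fixes f :: "'a::topological_space \<Rightarrow> ('b::topological_space) ^ 'm::finite"
    and g :: "'a \<Rightarrow> 'b ^ 'n::finite"
  assumes "continuous_on S f" "continuous_on S g"
  shows "continuous_on S (\<lambda>x. blk_join (f x) (g x))"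
proof -
  have "continuous_on S (\<lambda>x. case k of Inl i \<Rightarrow> f x $ i | Inr j \<Rightarrow> g x $ j)" for k
    using assms by (cases k) (simp_all add: continuous_on_component)
  then show ?thesis
    unfolding blk_join_def by (rule continuous_on_vec_lambda)
qed

lemma measurable_blk_join [measurable]:
  fixes f :: "'a \<Rightarrow> real ^ 'm::finite" and g :: "'a \<Rightarrow> real ^ 'n::finite"
  assumes [measurable]: "f \<in> borel_measurable M" "g \<in> borel_measurable M"
  shows "(\<lambda>x. blk_join (f x) (g x)) \<in> borel_measurable M"
  by (rule borel_measurable_continuous_Pair[OF assms]) (intro continuous_intros)

lemma measurable_blk_fst [measurable]:
  "(blk_fst :: real ^ ('m::finite + 'n::finite) \<Rightarrow> _) \<in> borel_measurable borel"
  unfolding blk_fst_def[abs_def]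
  by (intro borel_measurable_continuous_onI continuous_intros)

lemma measurable_blk_snd [measurable]:
  "(blk_snd :: real ^ ('m::finite + 'n::finite) \<Rightarrow> _) \<in> borel_measurable borel"
  unfolding blk_snd_def[abs_def]
  by (intro borel_measurable_continuous_onI continuous_intros)

lemma emeasure_lborel_box_cart:
  fixes l u :: "real ^ 'n::finite"
  assumes "\<And>i. l $ i \<le> u $ i"
  shows "emeasure lborel (box l u) = (\<Prod>i\<in>UNIV. u $ i - l $ i)"
proof -
  have Basis: "Basis = range (\<lambda>i::'n. axis i (1::real))"
    by (auto simp: Basis_vec_def)
  have "emeasure lborel (box l u) = (\<Prod>b\<in>Basis. (u - l) \<bullet> b)"
    using assms by (intro emeasure_lborel_box) (auto simp: Basis inner_axis)
  also have "(\<Prod>b\<in>Basis. (u - l) \<bullet> b) = (\<Prod>i\<in>UNIV. u $ i - l $ i)"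
    unfolding Basis by (subst prod.reindex) (auto simp: inj_on_def axis_eq_axis inner_axis)
  finally show ?thesis .
qed

text \<open>Lebesgue measure is determined by its values on boxes, and under joining the preimage of
  a box is the product of its two block boxes. The block versions of Tonelli's theorem rest on
  this.\<close>

lemma lborel_blk_join:
  "distr (lborel \<Otimes>\<^sub>M lborel) borel (\<lambda>p. blk_join (fst p) (snd p)) =
    (lborel :: (real ^ ('m::finite + 'n::finite)) measure)"
proof (rule lborel_eqI[symmetric])
  fix l u :: "real ^ ('m + 'n)"
  assume le: "\<And>b. b \<in> Basis \<Longrightarrow> l \<bullet> b \<le> u \<bullet> b"
  have le': "l $ k \<le> u $ k" for k
    using le[of "axis k 1"] by (simp add: inner_axis axis_in_Basis_iff)
  let ?B = "box (blk_fst l) (blk_fst u) \<times> box (blk_snd l) (blk_snd u)"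
  have vim: "(\<lambda>p. blk_join (fst p) (snd p)) -` box l u = ?B"
    by (auto simp: mem_box_cart blk_fst_def blk_snd_def blk_join_def split: sum.splits)
  have "emeasure (distr (lborel \<Otimes>\<^sub>M lborel) borel (\<lambda>p. blk_join (fst p) (snd p))) (box l u) =
      emeasure (lborel \<Otimes>\<^sub>M lborel) ?B"
    by (subst emeasure_distr) (simp_all add: vim space_pair_measure)
  also have "\<dots> = emeasure lborel (box (blk_fst l) (blk_fst u)) * emeasure lborel (box (blk_snd l) (blk_snd u))"
    by (rule lborel.emeasure_pair_measure_Times) auto
  also have "\<dots> = ennreal (\<Prod>i\<in>UNIV. u $ Inl i - l $ Inl i) * ennreal (\<Prod>j\<in>UNIV. u $ Inr j - l $ Inr j)"
    using le' by (simp add: emeasure_lborel_box_cart blk_fst_def blk_snd_def)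
  also have "\<dots> = ennreal (\<Prod>k\<in>UNIV. u $ k - l $ k)"
    using le' by (simp add: ennreal_mult[symmetric] prod_nonneg UNIV_Plus_UNIV[symmetric] prod.Plus del: UNIV_Plus_UNIV)
  also have "\<dots> = ennreal (\<Prod>b\<in>Basis. (u - l) \<bullet> b)"
    using le le' by (simp flip: emeasure_lborel_box_cart)
  finally show "emeasure (distr (lborel \<Otimes>\<^sub>M lborel) borel (\<lambda>p. blk_join (fst p) (snd p))) (box l u) =
      ennreal (\<Prod>b\<in>Basis. (u - l) \<bullet> b)" .
qed simp

lemma nn_integral_lborel_blk:
  fixes f :: "real ^ ('m::finite + 'n::finite) \<Rightarrow> ennreal"
  assumes [measurable]: "f \<in> borel_measurable borel"
  shows "(\<integral>\<^sup>+x. f x \<partial>lborel) = (\<integral>\<^sup>+u. \<integral>\<^sup>+v. f (blk_join u v) \<partial>lborel \<partial>lborel)"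
    and "(\<integral>\<^sup>+x. f x \<partial>lborel) = (\<integral>\<^sup>+v. \<integral>\<^sup>+u. f (blk_join u v) \<partial>lborel \<partial>lborel)"
proof -
  have *: "(\<integral>\<^sup>+x. f x \<partial>lborel) = (\<integral>\<^sup>+p. f (blk_join (fst p) (snd p)) \<partial>(lborel \<Otimes>\<^sub>M lborel))"
    by (subst lborel_blk_join[symmetric], subst nn_integral_distr) simp_all
  show "(\<integral>\<^sup>+x. f x \<partial>lborel) = (\<integral>\<^sup>+u. \<integral>\<^sup>+v. f (blk_join u v) \<partial>lborel \<partial>lborel)"
    unfolding * by (subst lborel.nn_integral_fst[symmetric]) simp_all
  show "(\<integral>\<^sup>+x. f x \<partial>lborel) = (\<integral>\<^sup>+v. \<integral>\<^sup>+u. f (blk_join u v) \<partial>lborel \<partial>lborel)"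
    unfolding * by (subst lborel_pair.nn_integral_snd[symmetric]) simp_all
qed

lemma AE_lborel_blk:
  fixes P :: "real ^ ('m::finite + 'n::finite) \<Rightarrow> bool"
  assumes "AE x in lborel. P x"
  shows "AE u in lborel. AE v in lborel. P (blk_join u v)"
proof -
  have "AE p in lborel \<Otimes>\<^sub>M lborel. P (blk_join (fst p) (snd p))"
    by (rule AE_distrD[where M'=borel]) (simp, simp only: lborel_blk_join assms)
  from lborel_pair.AE_pair[OF this] show ?thesis by simp
qed

section \<open>Measurability of the orthant and of the truncation box\<close>

lemma open_pos_orthant: "open (pos_orthant :: (real ^ 'n::finite) set)"
  unfolding pos_orthant_def Collect_all_eq
  by (intro open_INT finite_class.finite_UNIV ballI open_Collect_less continuous_intros)

lemma measurable_pos_orthant [measurable]: "pos_orthant \<in> sets (borel :: (real ^ 'n::finite) measure)"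
  by (intro borel_open open_pos_orthant)

lemma measurable_trunc_box [measurable]: "trunc_box a b \<in> sets (borel :: (real ^ 'n::finite) measure)"
proof -
  have "Measurable.pred borel (\<lambda>y :: real ^ 'n. \<forall>i. a $ i \<le> ereal (y $ i) \<and> ereal (y $ i) \<le> b $ i)"
    by measurable
  then show ?thesis by (simp add: trunc_box_def pred_def)
qed

section \<open>Null sets, lines and positive definite quadratic forms\<close>

text \<open>Away from the vertex \<open>- b / (2 * a)\<close> the derivative is nonzero, so
  preimages of negligible sets are negligible there; the vertex adds a single point.\<close>

lemma negligible_quadratic_vimage:
  fixes a b c :: real
  assumes "a \<noteq> 0" and N: "negligible N"
  shows "negligible {s. a * s\<^sup>2 + b * s + c \<in> N}"
proof -
  let ?S = "- {- b / (2 * a)}"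
  have "negligible {s \<in> ?S. a * s\<^sup>2 + b * s + c \<in> N}"
  proof (rule negligible_differentiable_vimage[OF N, where f' = "\<lambda>s d. (2 * a * s + b) * d"])
    fix s assume "s \<in> ?S"
    then have "2 * a * s + b \<noteq> 0"
      using \<open>a \<noteq> 0\<close> by (auto simp: field_simps eq_neg_iff_add_eq_0)
    then show "inj (\<lambda>d. (2 * a * s + b) * d)"
      by (simp add: inj_on_def)
    show "((\<lambda>s. a * s\<^sup>2 + b * s + c) has_derivative (\<lambda>d. (2 * a * s + b) * d)) (at s within ?S)"
      by (auto intro!: derivative_eq_intros simp: algebra_simps)
  qed
  then have "negligible ({s \<in> ?S. a * s\<^sup>2 + b * s + c \<in> N} \<union> {- b / (2 * a)})"
    by (simp add: negligible_Un)
  then show ?thesis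
    by (rule negligible_subset) auto
qed

text \<open>Integrate over \<open>u\<close> the length of the part of the line through
  \<open>u\<close> inside \<open>Z\<close>. Tonelli and translation invariance turn this into the
  measure of \<open>Z\<close> times the length of the real line, without a change of coordinates
  adapted to \<open>e\<close>.\<close>

lemma null_sets_lborel_iff_lines:
  fixes Z :: "'a::euclidean_space set"
  assumes [measurable]: "Z \<in> sets borel"
  shows "Z \<in> null_sets lborel \<longleftrightarrow> (AE u in lborel. {s. u + s *\<^sub>R e \<in> Z} \<in> null_sets lborel)"
proof -
  have line: "(\<integral>\<^sup>+s. indicator Z (u + s *\<^sub>R e) \<partial>lborel) = emeasure lborel {s::real. u + s *\<^sub>R e \<in> Z}" for u
  proof -
    have "(\<integral>\<^sup>+s. indicator Z (u + s *\<^sub>R e) \<partial>lborel) = (\<integral>\<^sup>+s. indicator {s::real. u + s *\<^sub>R e \<in> Z} s \<partial>lborel)"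
      by (simp add: indicator_def)
    also have "\<dots> = emeasure lborel {s::real. u + s *\<^sub>R e \<in> Z}"
      by (rule nn_integral_indicator) measurable
    finally show ?thesis .
  qed
  have transl: "(\<integral>\<^sup>+u. indicator Z (u + s *\<^sub>R e) \<partial>lborel) = emeasure lborel Z" for s :: real
  proof -
    have "emeasure lborel Z = (\<integral>\<^sup>+u. indicator Z u \<partial>distr lborel borel ((+) (s *\<^sub>R e)))"
      unfolding lborel_distr_plus by simp
    also have "\<dots> = (\<integral>\<^sup>+u. indicator Z (u + s *\<^sub>R e) \<partial>lborel)"
      by (subst nn_integral_distr) (simp_all add: add.commute)
    finally show ?thesis ..
  qed
  have "(\<integral>\<^sup>+u. emeasure lborel {s::real. u + s *\<^sub>R e \<in> Z} \<partial>lborel) =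
      (\<integral>\<^sup>+s. \<integral>\<^sup>+u. indicator Z (u + s *\<^sub>R e) \<partial>lborel \<partial>(lborel :: real measure))"
    unfolding line[symmetric] by (rule lborel_pair.Fubini'[symmetric]) simp
  \<comment> \<open>Since \<open>0 * \<infinity> = 0\<close>, this product vanishes exactly when
    \<open>Z\<close> is null.\<close>
  also have "\<dots> = emeasure lborel Z * \<infinity>"
    unfolding transl by (simp add: mult.commute)
  finally have "emeasure lborel Z * \<infinity> = (\<integral>\<^sup>+u. emeasure lborel {s::real. u + s *\<^sub>R e \<in> Z} \<partial>lborel)" ..
  moreover have [measurable]: "(\<lambda>u. emeasure lborel {s::real. u + s *\<^sub>R e \<in> Z}) \<in> borel_measurable lborel"
    unfolding line[symmetric] by measurable
  ultimately have "emeasure lborel Z = 0 \<longleftrightarrow> (AE u in lborel. emeasure lborel {s::real. u + s *\<^sub>R e \<in> Z} = 0)"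
    by (subst nn_integral_0_iff_AE[symmetric]) (auto simp: infinity_ennreal_def)
  then show ?thesis
    by (simp add: null_sets_def)
qed

text \<open>\<open>N\<close> collects the levels of \<open>A\<close> beyond which \<open>A\<close>
  has essentially nothing left. These are the values that \<open>q 0 y\<close> must avoid in the
  orthant argument.\<close>

lemma essential_right_end:
  fixes A :: "real set"
  assumes [measurable]: "A \<in> sets borel"
  obtains N where "N \<in> null_sets lborel"
    "\<And>t. t \<in> A \<Longrightarrow> A \<inter> {t<..} \<in> null_sets lborel \<Longrightarrow> t \<in> N"
proof -
  define T where "T = {t. A \<inter> {t<..} \<in> null_sets lborel}"
  define N where "N = (\<Union>r\<in>\<rat> \<inter> T. A \<inter> {r<..}) \<union> {Inf T}"
  \<comment> \<open>Apart from the left end of \<open>T\<close>, the points in question lie in countably many null sets.\<close>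
  have up: "t' \<in> T" if "t \<in> T" "t \<le> t'" for t t'
    using that unfolding T_def mem_Collect_eq
    by (elim null_sets_subset) auto
  have "N \<in> null_sets lborel"
    unfolding N_def
    by (intro null_sets.Un null_sets_UN' countable_Int1 countable_rat) (auto simp: T_def)
  moreover have "t \<in> N" if t: "t \<in> A" "A \<inter> {t<..} \<in> null_sets lborel" for t
  proof (cases "\<exists>t'\<in>T. t' < t")
    case True
    then obtain t' where "t' \<in> T" "t' < t" by auto
    moreover obtain r where "r \<in> \<rat>" "t' < r" "r < t"
      using Rats_dense_in_real[OF \<open>t' < t\<close>] by auto
    ultimately show ?thesis
      using up[of t' r] t unfolding N_def by auto
  next
    case False
    \<comment> \<open>Here \<open>t\<close> is the least element of \<open>T\<close>, the one case
      that the rational points of \<open>T\<close> miss; hence the extra point in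
      \<open>N\<close>.\<close>
    then have "Inf T = t"
      using t by (intro cInf_eq_minimum) (auto simp: T_def not_less)
    then show ?thesis by (simp add: N_def)
  qed
  ultimately show ?thesis using that by blast
qed

lemma quadratic_form_line:
  fixes B :: "real ^ 'n ^ 'n::finite" and u e :: "real ^ 'n"
  shows "(u + s *\<^sub>R e) \<bullet> (B *v (u + s *\<^sub>R e)) =
    e \<bullet> (B *v e) * s\<^sup>2 + (u \<bullet> (B *v e) + e \<bullet> (B *v u)) * s + u \<bullet> (B *v u)"
  by (simp add: matrix_vector_right_distrib matrix_vector_mult_scaleR inner_add_left inner_add_right
      algebra_simps power2_eq_square)

text \<open>Outside a null set of \<open>y\<close>, a non-null part of \<open>A\<close> lies to the right of \<open>q 0 y\<close>. On a
  ray into the orthant that starts close to \<open>0\<close>, \<open>q\<close> takes all values up to \<open>\<infinity>\<close> from a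
  point just above \<open>q 0 y\<close> on, so it hits \<open>A\<close> on a non-null set of parameters.\<close>

lemma AE_orthant_slice_not_null:
  fixes B :: "real ^ ('m::finite + 'n::finite) ^ ('m + 'n)" and \<xi> :: "real ^ ('m + 'n)"
  defines "q \<equiv> \<lambda>u y. (blk_join u y - \<xi>) \<bullet> (B *v (blk_join u y - \<xi>))"
  assumes B: "\<And>x. x \<noteq> 0 \<Longrightarrow> 0 < x \<bullet> (B *v x)" and A[measurable]: "A \<in> sets borel"
  shows "AE y in lborel. q 0 y \<in> A \<longrightarrow> {u \<in> pos_orthant. q u y \<in> A} \<notin> null_sets lborel"
proof -
  have cont: "continuous_on S (\<lambda>x. q (f x) (g x))"
    if "continuous_on S f" "continuous_on S g" for S f and g :: "'x::topological_space \<Rightarrow> _"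
    unfolding q_def using that
    by (intro continuous_intros continuous_on_compose2[OF matrix_vector_mult_linear_continuous_on[of UNIV B]]) auto
  \<comment> \<open>Only the leading coefficient is made explicit: it does not depend on the base
    point, and it is positive for \<open>d \<noteq> 0\<close>.\<close>
  have qu: "\<exists>b c. \<forall>s. q (u + s *\<^sub>R d) y = blk_join d 0 \<bullet> (B *v blk_join d 0) * s\<^sup>2 + b * s + c" for u d y
  proof -
    have line: "blk_join (u + s *\<^sub>R d) y - \<xi> = (blk_join u y - \<xi>) + s *\<^sub>R blk_join d 0" for s
      by (simp add: blk_join_def vec_eq_iff split: sum.split)
    show ?thesis unfolding q_def line quadratic_form_line by (intro exI allI) (rule refl)
  qed
  have qy: "\<exists>b c. \<forall>s. q u (y + s *\<^sub>R d) = blk_join 0 d \<bullet> (B *v blk_join 0 d) * s\<^sup>2 + b * s + c" for u d y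
  proof -
    have line: "blk_join u (y + s *\<^sub>R d) - \<xi> = (blk_join u y - \<xi>) + s *\<^sub>R blk_join 0 d" for s
      by (simp add: blk_join_def vec_eq_iff split: sum.split)
    show ?thesis unfolding q_def line quadratic_form_line by (intro exI allI) (rule refl)
  qed
  obtain N where N: "N \<in> null_sets lborel"
    and N_A: "\<And>t. t \<in> A \<Longrightarrow> A \<inter> {t<..} \<in> null_sets lborel \<Longrightarrow> t \<in> N"
    using essential_right_end[OF A] by metis
  have [measurable]: "N \<in> sets borel"
    using N by auto
  have [measurable]: "q 0 \<in> borel_measurable borel" "(\<lambda>u. q u y) \<in> borel_measurable borel" for y
    by (intro borel_measurable_continuous_onI cont continuous_intros)+
  \<comment> \<open>Along every line in the direction with all entries 1, \<open>q 0\<close> is a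
    genuine quadratic, so it takes values in the null set \<open>N\<close> only on a null set of
    parameters.\<close>
  have "{y. q 0 y \<in> N} \<in> null_sets lborel"
  proof (subst null_sets_lborel_iff_lines[where e = 1], measurable, rule AE_I2)
    fix y :: "real ^ 'n"
    have "blk_join (0 :: real ^ 'm) (1 :: real ^ 'n) \<noteq> 0"
      by (metis blk_snd_join one_neq_zero blk_join_fst_snd vec_eq_iff blk_join_nth(2) zero_index one_index)
    then have "blk_join 0 1 \<bullet> (B *v blk_join 0 1) \<noteq> 0"
      using B by (metis less_irrefl)
    moreover obtain b c where "\<forall>s. q 0 (y + s *\<^sub>R 1) = blk_join 0 1 \<bullet> (B *v blk_join 0 1) * s\<^sup>2 + b * s + c"
      using qy by blast
    ultimately have "negligible {s. q 0 (y + s *\<^sub>R 1) \<in> N}"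
      using negligible_quadratic_vimage[of _ N b c] N by (auto simp: negligible_iff_null_sets null_sets_completionI)
    then show "{s. y + s *\<^sub>R 1 \<in> {y. q 0 y \<in> N}} \<in> null_sets lborel"
      by (simp add: negligible_iff_null_sets null_sets_completion_iff)
  qed
  then have "AE y in lborel. y \<notin> {y. q 0 y \<in> N}"
    by (rule AE_not_in)
  then show ?thesis
  proof eventually_elim
    case (elim y)
    show ?case
    proof (intro impI notI)
      assume t: "q 0 y \<in> A" and null: "{u \<in> pos_orthant. q u y \<in> A} \<in> null_sets lborel"
      \<comment> \<open>As \<open>q 0 y\<close> avoids \<open>N\<close>, the part of
        \<open>A\<close> to its right is not null. Countable additivity moves the cut by a positive
        amount, which leaves room for rays that start away from \<open>0\<close>.\<close>
      have "\<exists>n. A \<inter> {q 0 y + inverse (Suc n)<..} \<notin> null_sets lborel"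
      proof (rule ccontr)
        assume "\<not> ?thesis"
        then have "(\<Union>n. A \<inter> {q 0 y + inverse (Suc n)<..}) \<in> null_sets lborel"
          by (intro null_sets_UN) auto
        also have "(\<Union>n. A \<inter> {q 0 y + inverse (Suc n)<..}) = A \<inter> {q 0 y<..}"
        proof (intro equalityI subsetI)
          fix t assume t: "t \<in> A \<inter> {q 0 y<..}"
          then obtain n where "inverse (Suc n) < t - q 0 y"
            using reals_Archimedean[of "t - q 0 y"] by auto
          then have "q 0 y + inverse (Suc n) < t" by (simp add: less_diff_eq add.commute)
          with t show "t \<in> (\<Union>n. A \<inter> {q 0 y + inverse (Suc n)<..})" by blast
        qed (auto elim!: less_trans[rotated])
        finally show False
          using N_A t elim by auto
      qed
      then obtain n where n: "A \<inter> {q 0 y + inverse (Suc n)<..} \<notin> null_sets lborel" ..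
      define \<tau> where "\<tau> = q 0 y + inverse (Suc n)"
      \<comment> \<open>\<open>U\<close> holds the starting points of the rays. It is nonempty
        because small positive multiples of the all-ones vector lie in the orthant with
        \<open>q\<close> close to \<open>q 0 y\<close>; \<open>0\<close> itself is outside the
        orthant.\<close>
      define U where "U = pos_orthant \<inter> {u. q u y < \<tau>}"
      have "open U"
        unfolding U_def
        by (intro open_Int open_pos_orthant open_Collect_less cont continuous_intros)
      have "((\<lambda>s. q (s *\<^sub>R 1) y) \<longlongrightarrow> q 0 y) (at_right 0)"
      proof -
        have "continuous_on UNIV (\<lambda>s. q (s *\<^sub>R 1) y)"
          by (intro cont continuous_intros)
        then show ?thesis
          using continuous_on_def[of UNIV] tendsto_within_subset[of _ _ 0 UNIV "{0<..}"] by force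
      qed
      then have "\<forall>\<^sub>F s in at_right 0. q (s *\<^sub>R 1) y < \<tau>"
        by (rule order_tendstoD) (simp add: \<tau>_def)
      moreover have "\<forall>\<^sub>F s in at_right (0::real). 0 < s"
        by (simp add: eventually_at_right_less)
      ultimately have "\<forall>\<^sub>F s in at_right (0::real). s *\<^sub>R 1 \<in> U"
        by eventually_elim (simp add: U_def pos_orthant_def)
      then have "U \<noteq> {}"
        using eventually_happens'[OF trivial_limit_at_right_real] by blast
      \<comment> \<open>If the slice is null, almost every line in the direction \<open>1\<close>
        meets it in a null set of parameters; \<open>U\<close> is not null, so some such line starts
        in \<open>U\<close>.\<close>
      have "AE u in lborel. {s. u + s *\<^sub>R 1 \<in> {u \<in> pos_orthant. q u y \<in> A}} \<in> null_sets lborel"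
        using null by (subst null_sets_lborel_iff_lines[symmetric]) auto
      moreover have "\<not> (AE u in lborel. u \<notin> U)"
        using \<open>open U\<close> \<open>U \<noteq> {}\<close> open_not_negligible[of U]
        by (auto simp: AE_iff_null_sets negligible_iff_null_sets null_sets_completionI dest: AE_completion)
      ultimately obtain u where u: "u \<in> U"
        and null_u: "{s. u + s *\<^sub>R 1 \<in> {u \<in> pos_orthant. q u y \<in> A}} \<in> null_sets lborel"
        by (metis (mono_tags, lifting) AE_mp AE_I2)
      let ?p = "\<lambda>s. q (u + s *\<^sub>R 1) y"
      obtain b c where p: "\<And>s. ?p s = blk_join 1 0 \<bullet> (B *v blk_join 1 0) * s\<^sup>2 + b * s + c"
        using qu by metis
      have "blk_join (1 :: real ^ 'm) (0 :: real ^ 'n) \<noteq> 0"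
        by (metis vec_eq_iff blk_join_nth(1) zero_index one_index one_neq_zero)
      then obtain a where a: "0 < a" and p: "\<And>s. ?p s = a * s\<^sup>2 + b * s + c"
        using B p by metis
      \<comment> \<open>The ray from \<open>u\<close> starts below \<open>\<tau>\<close> and
        \<open>?p\<close> is unbounded above on it, so the intermediate value theorem reaches every
        point of \<open>A\<close> above \<open>\<tau>\<close>.\<close>
      have "A \<inter> {\<tau><..} \<subseteq> ?p ` {s. u + s *\<^sub>R 1 \<in> {u \<in> pos_orthant. q u y \<in> A}}"
      proof
        fix t assume t: "t \<in> A \<inter> {\<tau><..}"
        \<comment> \<open>Chosen so that \<open>1 \<le> s1\<close> and
          \<open>\<bar>b\<bar> + \<bar>t - c\<bar> \<le> a * s1\<close>; then the quadratic term
          outweighs the others and \<open>t \<le> ?p s1\<close>.\<close>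
        define s1 where "s1 = 1 + (\<bar>b\<bar> + \<bar>t - c\<bar>) / a"
        have "1 \<le> s1" using a by (simp add: s1_def)
        have "\<bar>b\<bar> + \<bar>t - c\<bar> \<le> a * s1" using a by (simp add: s1_def field_simps)
        then have "s1 * (\<bar>b\<bar> + \<bar>t - c\<bar>) \<le> a * s1\<^sup>2"
          using \<open>1 \<le> s1\<close> by (simp add: power2_eq_square mult.commute mult.left_commute mult_left_mono)
        moreover have "- (b * s1) \<le> s1 * \<bar>b\<bar>"
          using \<open>1 \<le> s1\<close> by (metis abs_ge_minus_self abs_mult abs_of_nonneg mult.commute order_trans zero_le_one)
        moreover have "\<bar>t - c\<bar> \<le> s1 * \<bar>t - c\<bar>"
          using \<open>1 \<le> s1\<close> mult_right_mono[of 1 s1 "\<bar>t - c\<bar>"] by simp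
        ultimately have "t \<le> ?p s1"
          unfolding p by (simp add: algebra_simps)
        moreover have "?p 0 < t"
          using u t by (simp add: U_def)
        moreover have "continuous_on {0..s1} ?p"
          by (intro cont continuous_intros)
        ultimately obtain s where "0 \<le> s" "?p s = t"
          using IVT'[of ?p 0 t s1] \<open>1 \<le> s1\<close> by auto
        moreover have "u + s *\<^sub>R 1 \<in> pos_orthant"
          using u \<open>0 \<le> s\<close> by (simp add: U_def pos_orthant_def add_pos_nonneg)
        ultimately show "t \<in> ?p ` {s. u + s *\<^sub>R 1 \<in> {u \<in> pos_orthant. q u y \<in> A}}"
          using t by auto
      qed
      \<comment> \<open>A differentiable map of the line sends negligible sets to negligible sets,
        so \<open>A\<close> beyond \<open>\<tau>\<close> would be null, against the choice of
        \<open>n\<close>.\<close>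
      moreover have "negligible (?p ` {s. u + s *\<^sub>R 1 \<in> {u \<in> pos_orthant. q u y \<in> A}})"
        using null_u unfolding p power2_eq_square
        by (intro negligible_differentiable_image_negligible)
          (auto simp: negligible_iff_null_sets null_sets_completionI intro!: derivative_intros)
      ultimately have "negligible (A \<inter> {\<tau><..})"
        by (rule negligible_subset[rotated])
      then show False
        using n by (simp add: \<tau>_def negligible_iff_null_sets null_sets_completion_iff)
    qed
  qed
qed

section \<open>Positive definite matrices and elliptical densities\<close>

lemma pos_definite_invertible:
  assumes "pos_definite \<Omega>"
  shows "invertible \<Omega>"
  using assms unfolding pos_definite_def invertible_left_inverse matrix_left_invertible_ker
  by (metis inner_zero_right less_irrefl)

text \<open>With \<open>x = \<Omega> *v z\<close> the form of the inverse at \<open>x\<close> equals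
  the form of \<open>\<Omega>\<close> at \<open>z\<close>.\<close>

lemma pos_definite_matrix_inv:
  assumes \<Omega>: "pos_definite \<Omega>" and "x \<noteq> 0"
  shows "0 < x \<bullet> (matrix_inv \<Omega> *v x)"
proof -
  define z where "z = matrix_inv \<Omega> *v x"
  have "\<Omega> ** matrix_inv \<Omega> = mat 1"
    using someI_ex[OF pos_definite_invertible[OF \<Omega>, unfolded invertible_def]]
    by (simp add: matrix_inv_def)
  then have x: "x = \<Omega> *v z"
    by (simp add: z_def matrix_vector_mul_assoc)
  with \<open>x \<noteq> 0\<close> have "z \<noteq> 0"
    by (metis matrix_vector_mult_0_right)
  with \<Omega> show ?thesis
    unfolding z_def[symmetric] by (simp add: pos_definite_def x inner_commute)
qed

lemma ec_density_nonneg: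
  assumes "pos_definite \<Omega>" and "\<And>u. 0 \<le> u \<Longrightarrow> 0 \<le> h u"
  shows "0 \<le> ec_density \<xi> \<Omega> h x"
proof -
  have "0 \<le> (x - \<xi>) \<bullet> (matrix_inv \<Omega> *v (x - \<xi>))"
    using pos_definite_matrix_inv[OF assms(1), of "x - \<xi>"] by (cases "x = \<xi>") auto
  then show ?thesis using assms(2) by (simp add: ec_density_def)
qed

text \<open>\<open>distributed\<close> yields measurability of the coerced density only; for a
  non-negative function the coercion loses nothing.\<close>

lemma borel_measurable_ennreal_nonneg:
  fixes f :: "'a \<Rightarrow> real"
  assumes [measurable]: "(\<lambda>x. ennreal (f x)) \<in> borel_measurable M" and "\<And>x. 0 \<le> f x"
  shows "f \<in> borel_measurable M"
proof -
  have "(\<lambda>x. enn2real (ennreal (f x))) \<in> borel_measurable M" by measurable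
  then show ?thesis using assms(2) by simp
qed

text \<open>The density at \<open>x\<close> is positive exactly when the quadratic form at
  \<open>x - \<xi>\<close> lies in a fixed set \<open>A\<close> of levels, so the result on
  quadratic forms and orthant slices applies.\<close>

lemma AE_ec_density_orthant_slice:
  fixes \<xi> :: "real ^ ('m::finite + 'n::finite)"
  assumes \<Omega>: "pos_definite \<Omega>" and h: "\<And>u. 0 \<le> u \<Longrightarrow> 0 \<le> h u"
    and f[measurable]: "ec_density \<xi> \<Omega> h \<in> borel_measurable borel"
  shows "AE y in lborel. 0 < ec_density \<xi> \<Omega> h (blk_join 0 y) \<longrightarrow>
    0 < (\<integral>\<^sup>+u. ennreal (ec_density \<xi> \<Omega> h (blk_join u y)) * indicator pos_orthant u \<partial>lborel)"
proof -
  let ?Q = "\<lambda>x. x \<bullet> (matrix_inv \<Omega> *v x)"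
  define A where "A = {t. 0 \<le> t \<and> 0 < h t}"
  have Q_pos: "x \<noteq> 0 \<Longrightarrow> 0 < ?Q x" for x
    using pos_definite_matrix_inv[OF \<Omega>] .
  then have Q_nonneg: "0 \<le> ?Q x" for x
    by (cases "x = 0") (auto intro: less_imp_le)
  have "0 < det \<Omega> powr (- 1 / 2)"
    using pos_definite_invertible[OF \<Omega>] by (simp add: invertible_det_nz)
  then have pos_iff: "0 < ec_density \<xi> \<Omega> h x \<longleftrightarrow> ?Q (x - \<xi>) \<in> A" for x
    using Q_nonneg by (simp add: ec_density_def A_def zero_less_mult_iff)
  \<comment> \<open>Scaled so that the quadratic form equals \<open>t\<close> at
    \<open>sqrt t *\<^sub>R v\<close> for \<open>0 \<le> t\<close>. This expresses \<open>A\<close>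
    through the density, whose measurability is known.\<close>
  define v where "v = (1 / sqrt (?Q 1)) *\<^sub>R (1 :: real ^ ('m + 'n))"
  have "0 < ?Q 1" by (rule Q_pos) simp
  then have "?Q v = 1"
    by (simp add: v_def matrix_vector_mult_scaleR)
  then have "A = {t. 0 \<le> t \<and> 0 < ec_density \<xi> \<Omega> h (\<xi> + sqrt t *\<^sub>R v)}"
    unfolding pos_iff by (auto simp: matrix_vector_mult_scaleR A_def)
  also have "\<dots> \<in> sets borel"
    by measurable
  finally have [measurable]: "A \<in> sets borel" .
  have "AE y in lborel. ?Q (blk_join 0 y - \<xi>) \<in> A \<longrightarrow>
      {u \<in> pos_orthant. ?Q (blk_join u y - \<xi>) \<in> A} \<notin> null_sets lborel"
    by (rule AE_orthant_slice_not_null) (auto intro: Q_pos)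
  then show ?thesis
  proof eventually_elim
    case (elim y)
    have "{u \<in> pos_orthant. ?Q (blk_join u y - \<xi>) \<in> A} \<in> null_sets lborel"
      if "(\<integral>\<^sup>+u. ennreal (ec_density \<xi> \<Omega> h (blk_join u y)) * indicator pos_orthant u \<partial>lborel) = 0"
    proof -
      have "AE u in lborel. u \<notin> {u \<in> pos_orthant. ?Q (blk_join u y - \<xi>) \<in> A}"
        using that unfolding pos_iff[symmetric]
        by (subst (asm) nn_integral_0_iff_AE) (auto simp: indicator_def split: if_splits)
      moreover have "{u \<in> pos_orthant. ?Q (blk_join u y - \<xi>) \<in> A} \<in> sets lborel"
        unfolding pos_iff[symmetric] by measurable
      ultimately show ?thesis
        by (simp add: AE_iff_null_sets)
    qed
    with elim show ?case
      unfolding pos_iff by (auto simp: zero_less_iff_neq_zero)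
  qed
qed

section \<open>The law after selection\<close>

text \<open>Tonelli with the second block as outer variable: the inner integral runs over the
  selected first block, and the selection probability is a constant factor. This is Bayes' rule for
  the selected law.\<close>

lemma slct_ec_eq_density:
  fixes \<xi> :: "real ^ ('q::finite + 'p::finite)"
  assumes f[measurable]: "ec_density \<xi> \<Omega> h \<in> borel_measurable borel"
    and C[measurable]: "C \<in> sets borel"
  shows "slct_ec \<xi> \<Omega> h C = density lborel (\<lambda>y.
    (\<integral>\<^sup>+u. ennreal (ec_density \<xi> \<Omega> h (blk_join u y)) * indicator C u \<partial>lborel) /
      emeasure (ec_law \<xi> \<Omega> h) {x. blk_fst x \<in> C})"
proof (rule measure_eqI)
  fix B assume "B \<in> sets (slct_ec \<xi> \<Omega> h C)"
  then have [measurable]: "B \<in> sets borel" by (simp add: slct_ec_def)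
  let ?P = "emeasure (ec_law \<xi> \<Omega> h) {x. blk_fst x \<in> C}"
  have [simp]: "sets (ec_law \<xi> \<Omega> h) = sets borel" "space (ec_law \<xi> \<Omega> h) = UNIV"
    by (simp_all add: ec_law_def)
  have [measurable]: "blk_snd -` B \<in> sets (borel :: (real ^ ('q + 'p)) measure)"
    using measurable_sets[OF measurable_blk_snd, of B] by simp
  have [measurable]: "{x. blk_fst x \<in> C} \<in> sets (borel :: (real ^ ('q + 'p)) measure)"
    by measurable
  define S where "S y = (\<integral>\<^sup>+u. ennreal (ec_density \<xi> \<Omega> h (blk_join u y)) * indicator C u \<partial>lborel)" for y
  have [measurable]: "S \<in> borel_measurable borel"
    unfolding S_def by measurable
  have "emeasure (slct_ec \<xi> \<Omega> h C) B =
      emeasure (ec_law \<xi> \<Omega> h) ({x. blk_fst x \<in> C} \<inter> blk_snd -` B) / ?P"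
    unfolding slct_ec_def
    by (subst emeasure_distr) (simp_all cong: measurable_cong_sets)
  also have "emeasure (ec_law \<xi> \<Omega> h) ({x. blk_fst x \<in> C} \<inter> blk_snd -` B) =
      (\<integral>\<^sup>+x. ennreal (ec_density \<xi> \<Omega> h x) * indicator ({x. blk_fst x \<in> C} \<inter> blk_snd -` B) x \<partial>lborel)"
    unfolding ec_law_def by (subst emeasure_density) auto
  also have "\<dots> = (\<integral>\<^sup>+y. \<integral>\<^sup>+u. ennreal (ec_density \<xi> \<Omega> h (blk_join u y)) *
      indicator ({x. blk_fst x \<in> C} \<inter> blk_snd -` B) (blk_join u y) \<partial>lborel \<partial>lborel)"
    by (subst nn_integral_lborel_blk(2)) auto
  also have "\<dots> = (\<integral>\<^sup>+y. S y * indicator B y \<partial>lborel)"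
    unfolding S_def by (intro nn_integral_cong) (auto simp: indicator_def intro!: nn_integral_cong)
  also have "\<dots> / ?P = (\<integral>\<^sup>+y. S y * indicator B y / ?P \<partial>lborel)"
    by (rule nn_integral_divide[symmetric]) simp
  also have "\<dots> = emeasure (density lborel (\<lambda>y. S y / ?P)) B"
    by (subst emeasure_density) (auto simp: ennreal_times_divide mult.commute)
  finally show "emeasure (slct_ec \<xi> \<Omega> h C) B = emeasure (density lborel (\<lambda>y.
      (\<integral>\<^sup>+u. ennreal (ec_density \<xi> \<Omega> h (blk_join u y)) * indicator C u \<partial>lborel) / ?P)) B"
    unfolding S_def .
qed (simp add: slct_ec_def)

section \<open>Normalised densities and the identity on one slice\<close>

text \<open>A common form for the conditional laws, as functions of one variable. If
  \<open>f\<close> has integral 0 or is not integrable, the quotient is 0 and the measure is the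
  zero measure.\<close>

definition normalized_law :: "('u::euclidean_space \<Rightarrow> real) \<Rightarrow> 'u measure" where
  "normalized_law f = density lborel (\<lambda>u. ennreal (f u / (\<integral>u. f u \<partial>lborel)))"

lemma cond_law_eq_normalized_law: "cond_law f v = normalized_law (\<lambda>u. f u v)"
  by (simp add: cond_law_def cond_density_def normalized_law_def)

lemma sets_normalized_law [measurable_cong, simp]: "sets (normalized_law f) = sets borel"
  by (simp add: normalized_law_def)

text \<open>A vanishing normaliser does no harm: both sides are then 0, by the convention on
  division by 0.\<close>

lemma integral_normalized_law:
  fixes g :: "'u::euclidean_space \<Rightarrow> real"
  assumes [measurable]: "f \<in> borel_measurable borel" "g \<in> borel_measurable borel"
    and "\<And>u. 0 \<le> f u"
  shows "(\<integral>u. g u \<partial>normalized_law f) = (\<integral>u. f u * g u \<partial>lborel) / (\<integral>u. f u \<partial>lborel)"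
  unfolding normalized_law_def using assms(3)
  by (subst integral_density) (auto simp: integral_nonneg_AE)

lemma measure_normalized_law:
  assumes [measurable]: "f \<in> borel_measurable borel" "B \<in> sets borel"
    and "\<And>u. 0 \<le> f u"
  shows "measure (normalized_law f) B = (\<integral>u. f u * indicator B u \<partial>lborel) / (\<integral>u. f u \<partial>lborel)"
proof -
  have "measure (normalized_law f) B = (\<integral>u. indicator B u \<partial>normalized_law f)"
    by (simp add: normalized_law_def)
  also have "\<dots> = (\<integral>u. f u * indicator B u \<partial>lborel) / (\<integral>u. f u \<partial>lborel)"
    using assms(3) by (intro integral_normalized_law) auto
  finally show ?thesis .
qed

lemma integral_uniform_measure:
  fixes g :: "'a \<Rightarrow> real"
  assumes [measurable]: "g \<in> borel_measurable M" "B \<in> sets M" and B: "0 < measure M B"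
  shows "(\<integral>x. g x \<partial>uniform_measure M B) = (\<integral>x. indicator B x * g x \<partial>M) / measure M B"
proof -
  \<comment> \<open>\<open>measure\<close> is 0 on sets of infinite measure, so its positivity on
    \<open>B\<close> already gives finiteness.\<close>
  have "emeasure M B = ennreal (measure M B)"
    using B by (intro emeasure_eq_ennreal_measure) (auto simp: measure_def)
  then have "uniform_measure M B = density M (\<lambda>x. ennreal (indicator B x / measure M B))"
    unfolding uniform_measure_def using B
    by (intro density_cong) (auto simp: divide_ennreal[symmetric] ennreal_indicator)
  then show ?thesis
    by (simp add: integral_density)
qed

text \<open>The computation for one fixed \<open>y1\<close>. \<open>F u w\<close> is the joint
  density on that slice, \<open>C\<close> the orthant, \<open>c\<close> the zero vector,
  \<open>B\<close> the box of the second block; \<open>P\<close> and \<open>Q\<close> are the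
  probabilities of selection and of truncation. Both sides are brought to
  \<open>I / (P * \<sigma>)\<close>.\<close>

lemma selection_truncation_identity:
  fixes F :: "'u::euclidean_space \<Rightarrow> 'w::euclidean_space \<Rightarrow> real" and g :: "'w \<Rightarrow> real"
  assumes F[measurable]: "case_prod F \<in> borel_measurable (borel \<Otimes>\<^sub>M borel)"
    and F_nonneg: "\<And>u w. 0 \<le> F u w"
    and [measurable]: "C \<in> sets borel" "B \<in> sets borel" "g \<in> borel_measurable borel"
      "fy0 \<in> borel_measurable borel" "fy \<in> borel_measurable borel"
    and nonneg: "\<And>w. 0 \<le> fy0 w" "\<And>w. 0 \<le> fy w"
    and P: "0 < P" and Q: "0 < Q"
    and sel: "AE w in lborel. (\<integral>\<^sup>+u. ennreal (F u w) * indicator C u \<partial>lborel) = ennreal (P * fy0 w)"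
    and trunc: "AE w in lborel. fy w = indicator B w * fy0 w / Q"
    and supp: "AE w in lborel. 0 < F c w \<longrightarrow> 0 < fy0 w"
    and fin: "(\<integral>\<^sup>+w. \<integral>\<^sup>+u. ennreal (F u w) \<partial>lborel \<partial>lborel) < \<infinity>"
    and c: "0 < (\<integral>w. F c w \<partial>lborel) / (\<integral>u. \<integral>w. F u w \<partial>lborel \<partial>lborel)"
    and W: "0 < measure (normalized_law (F c)) B"
  shows "(\<integral>w. g w * (F c w / (\<integral>u. F u w \<partial>lborel) / measure (normalized_law (\<lambda>u. F u w)) C) \<partial>normalized_law fy) =
      measure (normalized_law (F c)) B / measure (normalized_law fy0) B *
      ((\<integral>w. g w \<partial>uniform_measure (normalized_law (F c)) B) /
        measure (normalized_law (\<lambda>u. \<integral>w. F u w \<partial>lborel)) C) *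
      ((\<integral>w. F c w \<partial>lborel) / (\<integral>u. \<integral>w. F u w \<partial>lborel \<partial>lborel))"
proof -
  \<comment> \<open>The factors on the right become \<open>\<beta> / K\<close>,
    \<open>\<sigma> / \<tau>\<close>, \<open>I / K / (\<beta> / K)\<close>,
    \<open>\<theta> / D\<close> and \<open>K / D\<close>, in the order of the statement.\<close>
  define I where "I = (\<integral>w. F c w * (indicator B w * g w) \<partial>lborel)"
  define K where "K = (\<integral>w. F c w \<partial>lborel)"
  define D where "D = (\<integral>u. \<integral>w. F u w \<partial>lborel \<partial>lborel)"
  define \<beta> where "\<beta> = (\<integral>w. F c w * indicator B w \<partial>lborel)"
  define \<sigma> where "\<sigma> = (\<integral>w. fy0 w * indicator B w \<partial>lborel)"
  define \<tau> where "\<tau> = (\<integral>w. fy0 w \<partial>lborel)"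
  define \<theta> where "\<theta> = (\<integral>u. (\<integral>w. F u w \<partial>lborel) * indicator C u \<partial>lborel)"
  have [measurable]: "(\<lambda>u. \<integral>w. F u w \<partial>lborel) \<in> borel_measurable borel"
    by (rule lborel.borel_measurable_lebesgue_integral[of _ borel, unfolded case_prod_beta', simplified]) measurable
  have [measurable]: "(\<lambda>w. \<integral>u. F u w \<partial>lborel) \<in> borel_measurable borel"
    by (rule lborel.borel_measurable_lebesgue_integral[of _ borel, unfolded case_prod_beta', simplified]) measurable
  have slice: "measure (normalized_law (\<lambda>u. F u w)) C = (\<integral>u. F u w * indicator C u \<partial>lborel) / (\<integral>u. F u w \<partial>lborel)" for w
    by (rule measure_normalized_law) (auto intro: F_nonneg)
  have [measurable]: "(\<lambda>w. \<integral>u. F u w * indicator C u \<partial>lborel) \<in> borel_measurable borel"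
    by (rule lborel.borel_measurable_lebesgue_integral[of _ borel, unfolded case_prod_beta', simplified]) measurable

  have "(\<integral>\<^sup>+u. \<integral>\<^sup>+w. ennreal (F u w) \<partial>lborel \<partial>lborel) = (\<integral>\<^sup>+w. \<integral>\<^sup>+u. ennreal (F u w) \<partial>lborel \<partial>lborel)"
    by (rule lborel_pair.Fubini') measurable
  \<comment> \<open>Finite total mass makes almost every slice integral finite, so that non-negative
    and Bochner integrals agree there.\<close>
  with fin have fin_u: "AE u in lborel. (\<integral>\<^sup>+w. ennreal (F u w) \<partial>lborel) \<noteq> \<infinity>"
    by (intro nn_integral_noteq_infinite) auto
  have fin_w: "AE w in lborel. (\<integral>\<^sup>+u. ennreal (F u w) \<partial>lborel) \<noteq> \<infinity>"
    using fin by (intro nn_integral_noteq_infinite) auto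

  \<comment> \<open>Integrating \<open>sel\<close> over \<open>w\<close> and exchanging the
    integrals: the mass of \<open>F\<close> over \<open>C\<close> is \<open>P\<close> times the mass
    of \<open>fy0\<close>.\<close>
  have "ennreal \<theta> = ennreal (P * \<tau>) \<and> integrable lborel fy0"
  proof -
    have "(\<integral>\<^sup>+w. ennreal (P * fy0 w) \<partial>lborel) =
        (\<integral>\<^sup>+w. \<integral>\<^sup>+u. ennreal (F u w) * indicator C u \<partial>lborel \<partial>lborel)"
      using sel by (intro nn_integral_cong_AE) auto
    also have "\<dots> = (\<integral>\<^sup>+u. \<integral>\<^sup>+w. ennreal (F u w) * indicator C u \<partial>lborel \<partial>lborel)"
      by (rule lborel_pair.Fubini') measurable
    also have "\<dots> = (\<integral>\<^sup>+u. ennreal ((\<integral>w. F u w \<partial>lborel) * indicator C u) \<partial>lborel)"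
    proof (rule nn_integral_cong_AE)
      show "AE u in lborel. (\<integral>\<^sup>+w. ennreal (F u w) * indicator C u \<partial>lborel) =
          ennreal ((\<integral>w. F u w \<partial>lborel) * indicator C u)"
        using fin_u
      proof eventually_elim
        case (elim u)
        then have "(\<integral>\<^sup>+w. ennreal (F u w) \<partial>lborel) = ennreal (\<integral>w. F u w \<partial>lborel)"
          by (subst integral_eq_nn_integral) (auto simp: F_nonneg less_top)
        then show ?case
          by (auto simp: indicator_def)
      qed
    qed
    finally have eq: "(\<integral>\<^sup>+w. ennreal (P * fy0 w) \<partial>lborel) = (\<integral>\<^sup>+u. ennreal ((\<integral>w. F u w \<partial>lborel) * indicator C u) \<partial>lborel)" .
    have "(\<integral>\<^sup>+w. ennreal (P * fy0 w) \<partial>lborel) \<le> (\<integral>\<^sup>+w. \<integral>\<^sup>+u. ennreal (F u w) \<partial>lborel \<partial>lborel)"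
    proof (rule nn_integral_mono_AE)
      show "AE w in lborel. ennreal (P * fy0 w) \<le> (\<integral>\<^sup>+u. ennreal (F u w) \<partial>lborel)"
        using sel
      proof eventually_elim
        case (elim w)
        show ?case unfolding elim[symmetric]
          by (intro nn_integral_mono) (auto simp: indicator_def)
      qed
    qed
    then have fin': "(\<integral>\<^sup>+w. ennreal (P * fy0 w) \<partial>lborel) < \<infinity>"
      using fin by (rule le_less_trans)
    then have int: "integrable lborel (\<lambda>w. P * fy0 w)"
      using P by (intro integrableI_nonneg) (auto simp: nonneg)
    have "P * \<tau> = (\<integral>w. P * fy0 w \<partial>lborel)" by (simp add: \<tau>_def)
    also have "\<dots> = enn2real (\<integral>\<^sup>+w. ennreal (P * fy0 w) \<partial>lborel)"
      using P by (intro integral_eq_nn_integral) (auto simp: nonneg)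
    also have "\<dots> = \<theta>"
      unfolding \<theta>_def eq
      by (intro integral_eq_nn_integral[symmetric]) (auto simp: F_nonneg integral_nonneg_AE)
    finally show ?thesis
      using int P by simp
  qed
  then have int_fy0: "integrable lborel fy0" and "ennreal \<theta> = ennreal (P * \<tau>)" by auto
  moreover have \<tau>: "0 \<le> \<tau>" unfolding \<tau>_def by (intro integral_nonneg_AE AE_I2 nonneg)
  moreover have "0 \<le> \<theta>" unfolding \<theta>_def by (intro integral_nonneg_AE AE_I2 mult_nonneg_nonneg F_nonneg) auto
  ultimately have \<theta>: "\<theta> = P * \<tau>" using P by simp
  have "integrable lborel (\<lambda>w. fy0 w * indicator B w)"
    using integrable_mult_indicator[of B lborel fy0] int_fy0 by (simp add: mult.commute)
  \<comment> \<open>The bound by \<open>\<tau>\<close> serves the degenerate case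
    \<open>\<tau> = 0\<close> at the end.\<close>
  then have \<sigma>: "0 \<le> \<sigma>" "\<sigma> \<le> \<tau>"
    unfolding \<sigma>_def \<tau>_def using int_fy0 nonneg
    by (auto intro!: integral_nonneg_AE integral_mono simp: mult_left_le indicator_def)

  have m: "(\<integral>w. fy w \<partial>lborel) = \<sigma> / Q"
  proof -
    have "(\<integral>w. fy w \<partial>lborel) = (\<integral>w. fy0 w * indicator B w / Q \<partial>lborel)"
      using trunc by (intro integral_cong_AE) (auto simp: mult.commute)
    then show ?thesis by (simp add: \<sigma>_def)
  qed
  have "(\<integral>w. g w * (F c w / (\<integral>u. F u w \<partial>lborel) / measure (normalized_law (\<lambda>u. F u w)) C) \<partial>normalized_law fy) =
      (\<integral>w. fy w * (g w * (F c w / (\<integral>u. F u w \<partial>lborel) / measure (normalized_law (\<lambda>u. F u w)) C)) \<partial>lborel) / (\<sigma> / Q)"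
    unfolding slice m[symmetric] by (rule integral_normalized_law) (auto simp: nonneg)
  \<comment> \<open>The two conditional quantities share the integral of \<open>F u w\<close> over
    \<open>u\<close> as normaliser, which leaves \<open>F c w / (P * fy0 w)\<close>; then
    \<open>fy0 w\<close> cancels against the same factor of the truncated density.\<close>
  also have "(\<integral>w. fy w * (g w * (F c w / (\<integral>u. F u w \<partial>lborel) / measure (normalized_law (\<lambda>u. F u w)) C)) \<partial>lborel) =
      (\<integral>w. F c w * (indicator B w * g w) / (P * Q) \<partial>lborel)"
    unfolding slice
  proof (rule integral_cong_AE)
    show "AE w in lborel. fy w * (g w * (F c w / (\<integral>u. F u w \<partial>lborel) /
        ((\<integral>u. F u w * indicator C u \<partial>lborel) / (\<integral>u. F u w \<partial>lborel)))) =
        F c w * (indicator B w * g w) / (P * Q)"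
      using sel trunc supp fin_w
    proof eventually_elim
      case (elim w)
      have s: "(\<integral>u. F u w * indicator C u \<partial>lborel) = P * fy0 w"
        using P elim(1) by (subst integral_eq_nn_integral)
          (auto simp: F_nonneg nonneg ennreal_mult' enn2real_mult ennreal_indicator[symmetric] simp del: ennreal_indicator)
      show ?case
      proof (cases "fy0 w = 0")
        case True
        \<comment> \<open>The support condition enters here: the left side is 0 when
          \<open>fy0 w = 0\<close>, so the right side has to vanish as well.\<close>
        then have "F c w = 0" using elim(3) F_nonneg[of c w] by auto
        then show ?thesis by simp
      next
        case False
        \<comment> \<open>Integrability keeps the integral over all \<open>u\<close> from defaulting
          to 0; it then dominates the positive integral over \<open>C\<close>, and the normaliser
          cancels.\<close>
        have "integrable lborel (\<lambda>u. F u w)"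
          using elim(4) by (intro integrableI_nonneg) (auto simp: F_nonneg less_top)
        moreover from this have "integrable lborel (\<lambda>u. F u w * indicator C u)"
          using integrable_mult_indicator[of C lborel "\<lambda>u. F u w"] by (simp add: mult.commute)
        ultimately have "(\<integral>u. F u w * indicator C u \<partial>lborel) \<le> (\<integral>u. F u w \<partial>lborel)"
          using F_nonneg by (intro integral_mono) (auto simp: indicator_def)
        moreover have "0 < P * fy0 w" using False P nonneg(1)[of w] by (simp add: less_le)
        ultimately have "0 < (\<integral>u. F u w \<partial>lborel)" using s by linarith
        then show ?thesis
          using False P Q elim(2) unfolding s by (simp add: field_simps)
      qed
    qed
  qed measurable
  also have "\<dots> / (\<sigma> / Q) = I / (P * \<sigma>)"
    using P Q by (simp add: I_def)
  finally have lhs: "(\<integral>w. g w * (F c w / (\<integral>u. F u w \<partial>lborel) / measure (normalized_law (\<lambda>u. F u w)) C) \<partial>normalized_law fy) =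
      I / (P * \<sigma>)" .

  have W0: "measure (normalized_law (F c)) B = \<beta> / K"
    unfolding \<beta>_def K_def by (rule measure_normalized_law) (auto simp: F_nonneg)
  have Y0: "measure (normalized_law fy0) B = \<sigma> / \<tau>"
    unfolding \<sigma>_def \<tau>_def by (rule measure_normalized_law) (auto simp: nonneg)
  have X1: "measure (normalized_law (\<lambda>u. \<integral>w. F u w \<partial>lborel)) C = \<theta> / D"
    unfolding \<theta>_def D_def by (rule measure_normalized_law) (auto simp: F_nonneg integral_nonneg_AE)
  have W2: "(\<integral>w. g w \<partial>uniform_measure (normalized_law (F c)) B) = I / K / (\<beta> / K)"
    unfolding I_def K_def using W
    by (subst integral_uniform_measure)
      (auto simp: W0 K_def F_nonneg integral_normalized_law)
  \<comment> \<open>A quotient by 0 is 0, so positivity of the quotients in \<open>W\<close> and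
    \<open>c\<close> makes all three nonzero.\<close>
  have "\<beta> \<noteq> 0" "K \<noteq> 0" "D \<noteq> 0"
    using W c unfolding W0 K_def[symmetric] D_def[symmetric] by auto
  \<comment> \<open>If \<open>\<tau> = 0\<close> then \<open>\<sigma> = 0\<close>, and both sides
    are 0.\<close>
  then have "\<beta> / K / (\<sigma> / \<tau>) * (I / K / (\<beta> / K) / (\<theta> / D)) * (K / D) = I / (P * \<sigma>)"
    using \<sigma> P unfolding \<theta> by (cases "\<tau> = 0") (auto simp: field_simps)
  then show ?thesis
    unfolding lhs W0 Y0 X1 W2 K_def[symmetric] D_def[symmetric] by simp
qed

section \<open>From Lebesgue almost every to almost every value of the first block\<close>

lemma blk_join_in_trunc_box_iff:
  "blk_join u v \<in> trunc_box a b \<longleftrightarrow>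
    u \<in> trunc_box (blk_fst a) (blk_fst b) \<and> v \<in> trunc_box (blk_snd a) (blk_snd b)"
  by (auto simp: trunc_box_def blk_fst_def blk_snd_def blk_join_def split: sum.split)

text \<open>\<open>Y\<close> has a density, and by Tonelli the cylinder over a null set of first
  blocks is null; hence the law of the first block puts no mass on Lebesgue null sets.\<close>

lemma AE_distr_blk_fst:
  fixes Y :: "'t \<Rightarrow> real ^ ('m::finite + 'n::finite)"
  assumes Y[measurable]: "Y \<in> borel_measurable N" "distributed N lborel Y f"
    and P: "AE u in lborel. P u"
  shows "AE u in distr N borel (\<lambda>\<omega>. blk_fst (Y \<omega>)). P u"
proof -
  obtain Z where Z: "{u \<in> space lborel. \<not> P u} \<subseteq> Z" "Z \<in> null_sets lborel"
    using P by (auto simp: eventually_ae_filter)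
  then have [measurable]: "Z \<in> sets borel" by auto
  have "(\<integral>\<^sup>+y. indicator Z (blk_fst y) \<partial>(lborel :: (real ^ ('m + 'n)) measure)) =
      (\<integral>\<^sup>+v. \<integral>\<^sup>+u. indicator Z u \<partial>lborel \<partial>(lborel :: (real ^ 'n) measure))"
    by (subst nn_integral_lborel_blk(2)) auto
  also have "\<dots> = 0" using Z by auto
  finally have "AE y :: real ^ ('m + 'n) in lborel. blk_fst y \<notin> Z"
    by (subst (asm) nn_integral_0_iff_AE) (auto simp: indicator_def split: if_splits)
  moreover have "f \<in> borel_measurable lborel"
    using Y(2) by (rule distributed_borel_measurable)
  ultimately have "AE y in distr N lborel Y. blk_fst y \<notin> Z"
    unfolding distributed_distr_eq_density[OF Y(2)] by (subst AE_density) auto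
  then have "AE \<omega> in N. blk_fst (Y \<omega>) \<notin> Z"
    by (subst (asm) AE_distr_iff) auto
  then have "AE u in distr N borel (\<lambda>\<omega>. blk_fst (Y \<omega>)). u \<notin> Z"
    by (subst AE_distr_iff) auto
  then show ?thesis
    by eventually_elim (use Z in auto)
qed

text \<open>\<open>fY\<close> and \<open>fY0\<close> are arbitrary versions of the densities, so
  their slices make sense only for almost every \<open>y1\<close>. The premises on \<open>y1\<close>
  are the understood conditions: \<open>W0s\<close> and its truncation are defined, and both
  expectations exist.\<close>

theorem lemma2:
  fixes M :: "'s measure" and N :: "'t measure" and N0 :: "'r measure"
    and X :: "'s \<Rightarrow> real ^ ('q::finite + ('p1::finite + 'p2::finite))"
    and Y :: "'t \<Rightarrow> real ^ ('p1 + 'p2)"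
    and Y0 :: "'r \<Rightarrow> real ^ ('p1 + 'p2)"
    and \<xi> :: "real ^ ('q + ('p1 + 'p2))"
    and \<Omega> :: "real ^ ('q + ('p1 + 'p2)) ^ ('q + ('p1 + 'p2))"
    and h :: "real \<Rightarrow> real"
    and a b :: "ereal ^ ('p1 + 'p2)"
    and fY fY0 :: "real ^ ('p1 + 'p2) \<Rightarrow> real"
    and g :: "real ^ 'p2 \<Rightarrow> real"
  defines "fX \<equiv> ec_density \<xi> \<Omega> h"
  defines "fX1_X2 \<equiv> (\<lambda>x1 x2. fX (blk_join x1 x2))"
  defines "fX1_X21 \<equiv> (\<lambda>x1 y1. \<integral>w. fX (blk_join x1 (blk_join y1 w)) \<partial>lborel)"
  defines "X1s \<equiv> (\<lambda>y1. cond_law fX1_X21 y1)"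
  defines "Y0s \<equiv> (\<lambda>y1. cond_law (\<lambda>y2 y1. fY0 (blk_join y1 y2)) y1)"
  defines "W0s \<equiv> (\<lambda>y1. cond_law (\<lambda>w (y1, x1). fX (blk_join x1 (blk_join y1 w))) (y1, 0))"
  defines "W2 \<equiv> (\<lambda>y1. uniform_measure (W0s y1) (trunc_box (blk_snd a) (blk_snd b)))"
  defines "Y2_given \<equiv> (\<lambda>y1. cond_law (\<lambda>y2 y1. fY (blk_join y1 y2)) y1)"
  defines "G \<equiv> (\<lambda>y1 y2. g y2 * (cond_density fX1_X2 (blk_join y1 y2) 0 /
                     measure (cond_law fX1_X2 (blk_join y1 y2)) pos_orthant))"
  assumes X: "elliptical M X \<xi> \<Omega> h"
    and pos_sel: "measure M {\<omega> \<in> space M. blk_fst (X \<omega>) \<in> pos_orthant} > 0"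
    and N0: "prob_space N0"
    and Y0: "Y0 \<in> borel_measurable N0" "distr N0 borel Y0 = slct_ec \<xi> \<Omega> h pos_orthant"
    and fY0: "\<And>y. 0 \<le> fY0 y" "distributed N0 lborel Y0 (\<lambda>y. ennreal (fY0 y))"
    and pos_trunc: "measure N0 {\<omega> \<in> space N0. Y0 \<omega> \<in> trunc_box a b} > 0"
    and N: "prob_space N"
    and Y: "Y \<in> borel_measurable N" "distr N borel Y = tslct_ec \<xi> \<Omega> h pos_orthant a b"
    and fY: "\<And>y. 0 \<le> fY y" "distributed N lborel Y (\<lambda>y. ennreal (fY y))"
    and g: "g \<in> borel_measurable borel"
  shows "AE y1 in distr N borel (\<lambda>\<omega>. blk_fst (Y \<omega>)).
    cond_density fX1_X21 y1 0 > 0 \<longrightarrow>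
    measure (W0s y1) (trunc_box (blk_snd a) (blk_snd b)) > 0 \<longrightarrow>
    integrable (W2 y1) g \<longrightarrow>
    integrable (Y2_given y1) (G y1) \<longrightarrow>
    (\<integral>y2. G y1 y2 \<partial>Y2_given y1) =
      measure (W0s y1) (trunc_box (blk_snd a) (blk_snd b)) /
      measure (Y0s y1) (trunc_box (blk_snd a) (blk_snd b)) *
      ((\<integral>w. g w \<partial>W2 y1) / measure (X1s y1) pos_orthant) *
      cond_density fX1_X21 y1 0"
proof -
  have M: "prob_space M" and \<Omega>: "pos_definite \<Omega>" and h: "\<And>u. 0 \<le> u \<Longrightarrow> 0 \<le> h u"
    and X': "distributed M lborel X (\<lambda>x. ennreal (fX x))"
    using X by (auto simp: elliptical_def fX_def)
  interpret M: prob_space M by fact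
  interpret N0: prob_space N0 by fact

  have fX_nonneg: "0 \<le> fX x" for x
    unfolding fX_def using \<Omega> h by (rule ec_density_nonneg)
  have fX [measurable]: "fX \<in> borel_measurable borel"
    using borel_measurable_ennreal_nonneg[OF distributed_borel_measurable[OF X'] fX_nonneg] by simp
  have fY0' [measurable]: "fY0 \<in> borel_measurable borel"
    using borel_measurable_ennreal_nonneg[OF distributed_borel_measurable[OF fY0(2)] fY0(1)] by simp
  have fY' [measurable]: "fY \<in> borel_measurable borel"
    using borel_measurable_ennreal_nonneg[OF distributed_borel_measurable[OF fY(2)] fY(1)] by simp
  have X_meas [measurable]: "X \<in> borel_measurable M"
    using distributed_measurable[OF X'] by simp
  note Y(1) [measurable] Y0(1) [measurable] g [measurable]

  define P where "P = measure M {\<omega> \<in> space M. blk_fst (X \<omega>) \<in> pos_orthant}"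
  define Q where "Q = measure N0 {\<omega> \<in> space N0. Y0 \<omega> \<in> trunc_box a b}"
  define S where "S y = (\<integral>\<^sup>+u. ennreal (fX (blk_join u y)) * indicator pos_orthant u \<partial>lborel)" for y
  have [measurable]: "S \<in> borel_measurable borel"
    unfolding S_def by measurable
  have P: "0 < P" and Q: "0 < Q"
    using pos_sel pos_trunc by (auto simp: P_def Q_def)
  have ec_law: "ec_law \<xi> \<Omega> h = distr M lborel X"
    using distributed_distr_eq_density[OF X'] by (simp add: ec_law_def fX_def)
  have emeasure_P: "emeasure (ec_law \<xi> \<Omega> h) {x. blk_fst x \<in> pos_orthant} = ennreal P"
    unfolding ec_law P_def M.emeasure_eq_measure[symmetric]
    by (subst emeasure_distr) (auto intro!: arg_cong[where f = "emeasure M"])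
  have emeasure_Q: "emeasure (slct_ec \<xi> \<Omega> h pos_orthant) (trunc_box a b) = ennreal Q"
    unfolding Y0(2)[symmetric] Q_def N0.emeasure_eq_measure[symmetric]
    by (subst emeasure_distr) (auto intro!: arg_cong[where f = "emeasure N0"])
  have slct: "slct_ec \<xi> \<Omega> h pos_orthant = density lborel (\<lambda>y. ennreal (fY0 y))"
    using distributed_distr_eq_density[OF fY0(2)] Y0(2) distr_cong[of N0 N0 borel lborel Y0 Y0]
    by simp

  \<comment> \<open>Uniqueness of densities up to null sets: the law of \<open>Y0\<close> has the
    density \<open>fY0\<close> and, by Bayes' rule, also \<open>S\<close> divided by
    \<open>P\<close>.\<close>
  have A1: "AE y in lborel. S y = ennreal (P * fY0 y)"
  proof -
    have "density lborel (\<lambda>y. ennreal (fY0 y)) = density lborel (\<lambda>y. S y / ennreal P)"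
      unfolding slct[symmetric] S_def emeasure_P[symmetric] fX_def
      by (rule slct_ec_eq_density) (use fX in \<open>simp_all add: fX_def\<close>)
    then have "AE y in lborel. ennreal (fY0 y) = S y / ennreal P"
      by (intro sigma_finite_measure.density_unique[OF sigma_finite_lborel]) auto
    then show ?thesis
    proof eventually_elim
      case (elim y)
      have "S y = ennreal P * (S y / ennreal P)"
        using P by (simp add: ennreal_times_divide mult.commute[of _ "S y"] ennreal_mult_divide_eq)
      then show ?case
        using P elim by (simp add: ennreal_mult fY0(1))
    qed
  qed
  \<comment> \<open>Truncation multiplies the selected density by the normalised indicator of the
    box; uniqueness of densities applies again.\<close>
  have A2: "AE y in lborel. fY y = indicator (trunc_box a b) y * fY0 y / Q"
  proof -
    have "density lborel (\<lambda>y. ennreal (fY y)) = tslct_ec \<xi> \<Omega> h pos_orthant a b"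
      using distributed_distr_eq_density[OF fY(2)] Y(2) distr_cong[of N N borel lborel Y Y]
      by simp
    also have "\<dots> = density lborel (\<lambda>y. ennreal (fY0 y) * (indicator (trunc_box a b) y / ennreal Q))"
      unfolding tslct_ec_def uniform_measure_def emeasure_Q unfolding slct
      by (rule density_density_eq) auto
    finally have "AE y in lborel. ennreal (fY y) = ennreal (fY0 y) * (indicator (trunc_box a b) y / ennreal Q)"
      by (intro sigma_finite_measure.density_unique[OF sigma_finite_lborel]) auto
    then show ?thesis
    proof eventually_elim
      case (elim y)
      also have "ennreal (fY0 y) * (indicator (trunc_box a b) y / ennreal Q) =
          ennreal (indicator (trunc_box a b) y * fY0 y / Q)"
        using Q by (auto simp: indicator_def divide_ennreal[symmetric] ennreal_times_divide fY0(1))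
      finally show ?case
        using Q fY(1) fY0(1) by (subst (asm) ennreal_inj) auto
    qed
  qed
  \<comment> \<open>\<open>A1\<close> carries positivity of the orthant integral \<open>S\<close>
    over to \<open>fY0\<close>; this supplies the support condition on the slices.\<close>
  have A3: "AE y in lborel. 0 < fX (blk_join 0 y) \<longrightarrow> 0 < fY0 y"
  proof -
    have "AE y in lborel. 0 < fX (blk_join 0 y) \<longrightarrow> 0 < S y"
      unfolding fX_def S_def
      by (rule AE_ec_density_orthant_slice[OF \<Omega>]) (fact h, fact fX[unfolded fX_def])
    with A1 show ?thesis
      by eventually_elim (use P in \<open>auto simp: zero_less_mult_iff\<close>)
  qed
  \<comment> \<open>The integral over all three blocks is the total mass 1, so the inner two
    integrals are finite for almost every \<open>y1\<close>.\<close>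
  have A4: "AE y1 in lborel. (\<integral>\<^sup>+w. \<integral>\<^sup>+u. ennreal (fX (blk_join u (blk_join y1 w))) \<partial>lborel \<partial>lborel) \<noteq> \<infinity>"
  proof (rule nn_integral_noteq_infinite)
    have "(\<integral>\<^sup>+y1. \<integral>\<^sup>+w. \<integral>\<^sup>+u. ennreal (fX (blk_join u (blk_join y1 w))) \<partial>lborel \<partial>lborel \<partial>lborel) =
        (\<integral>\<^sup>+x. ennreal (fX x) \<partial>lborel)"
      by (subst nn_integral_lborel_blk(2)[of "\<lambda>x. ennreal (fX x)"], simp,
          subst nn_integral_lborel_blk(1)[where f = "\<lambda>y. \<integral>\<^sup>+u. ennreal (fX (blk_join u y)) \<partial>lborel"]) simp_all
    also have "\<dots> = emeasure (distr M lborel X) UNIV"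
      unfolding distributed_distr_eq_density[OF X'] by (subst emeasure_density) auto
    also have "\<dots> = 1"
      by (subst emeasure_distr) (simp_all add: M.emeasure_space_1)
    finally show "(\<integral>\<^sup>+y1. \<integral>\<^sup>+w. \<integral>\<^sup>+u. ennreal (fX (blk_join u (blk_join y1 w))) \<partial>lborel \<partial>lborel \<partial>lborel) \<noteq> \<infinity>"
      by simp
  qed measurable

  \<comment> \<open>The first block of \<open>Y\<close> stays in its part of the box, so for these
    \<open>y1\<close> the indicator of the full box reduces to that of the second block.\<close>
  have "AE y in distr N borel Y. y \<in> trunc_box a b"
    unfolding Y(2) tslct_ec_def
    by (rule AE_uniform_measureI) (auto simp: slct_ec_def)
  then have "AE \<omega> in N. Y \<omega> \<in> trunc_box a b"
    by (subst (asm) AE_distr_iff) auto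
  then have "AE \<omega> in N. blk_fst (Y \<omega>) \<in> trunc_box (blk_fst a) (blk_fst b)"
    by eventually_elim (metis blk_join_fst_snd blk_join_in_trunc_box_iff)
  then have "AE y1 in distr N borel (\<lambda>\<omega>. blk_fst (Y \<omega>)). y1 \<in> trunc_box (blk_fst a) (blk_fst b)"
    by (subst AE_distr_iff) auto
  with AE_distr_blk_fst[OF Y(1) fY(2) AE_lborel_blk[OF A1]]
    AE_distr_blk_fst[OF Y(1) fY(2) AE_lborel_blk[OF A2]]
    AE_distr_blk_fst[OF Y(1) fY(2) AE_lborel_blk[OF A3]]
    AE_distr_blk_fst[OF Y(1) fY(2) A4]
  show ?thesis
  proof eventually_elim
    case (elim y1)
    let ?F = "\<lambda>u w. fX (blk_join u (blk_join y1 w))"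
    let ?B = "trunc_box (blk_snd a) (blk_snd b)"
    \<comment> \<open>Every conditional law unfolds to a normalised slice; what remains is the
      one-slice identity for \<open>?F\<close>.\<close>
    have W0s: "W0s y1 = normalized_law (?F 0)" and Y0s: "Y0s y1 = normalized_law (\<lambda>w. fY0 (blk_join y1 w))"
      and X1s: "X1s y1 = normalized_law (\<lambda>u. \<integral>w. ?F u w \<partial>lborel)"
      and Y2_given: "Y2_given y1 = normalized_law (\<lambda>w. fY (blk_join y1 w))"
      and c: "cond_density fX1_X21 y1 0 = (\<integral>w. ?F 0 w \<partial>lborel) / (\<integral>u. \<integral>w. ?F u w \<partial>lborel \<partial>lborel)"
      and G: "G y1 = (\<lambda>w. g w * (?F 0 w / (\<integral>u. ?F u w \<partial>lborel) / measure (normalized_law (\<lambda>u. ?F u w)) pos_orthant))"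
      by (simp_all add: W0s_def Y0s_def X1s_def Y2_given_def G_def fX1_X21_def fX1_X2_def
          cond_law_eq_normalized_law cond_density_def)
    show ?case
      unfolding W2_def W0s Y0s X1s Y2_given c G
    proof (intro impI)
      assume c: "0 < (\<integral>w. ?F 0 w \<partial>lborel) / (\<integral>u. \<integral>w. ?F u w \<partial>lborel \<partial>lborel)"
        and W: "0 < measure (normalized_law (?F 0)) ?B"
      have trunc: "AE w in lborel. fY (blk_join y1 w) = indicator ?B w * fY0 (blk_join y1 w) / Q"
        using elim(2) by eventually_elim (use elim(5) in \<open>simp add: indicator_def blk_join_in_trunc_box_iff\<close>)
      show "(\<integral>w. g w * (?F 0 w / (\<integral>u. ?F u w \<partial>lborel) / measure (normalized_law (\<lambda>u. ?F u w)) pos_orthant)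
            \<partial>normalized_law (\<lambda>w. fY (blk_join y1 w))) =
          measure (normalized_law (?F 0)) ?B / measure (normalized_law (\<lambda>w. fY0 (blk_join y1 w))) ?B *
          ((\<integral>w. g w \<partial>uniform_measure (normalized_law (?F 0)) ?B) /
            measure (normalized_law (\<lambda>u. \<integral>w. ?F u w \<partial>lborel)) pos_orthant) *
          ((\<integral>w. ?F 0 w \<partial>lborel) / (\<integral>u. \<integral>w. ?F u w \<partial>lborel \<partial>lborel))"
        by (rule selection_truncation_identity[where P = P and Q = Q])
          (use elim P Q c W trunc in \<open>auto simp: S_def less_top fX_nonneg fY(1) fY0(1)\<close>)
    qed
  qed
qed

end
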